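(* For online square packing, every online algorithm has asymptotic competitive ratio at least $1.7515445$.
   Context: In square packing, the input is a sequence of squares whose side lengths are rational numbers in $(0,1]$. The squares must be packed into unit square bins, axis-parallel and non-overlapping, where two squares overlap only if their interiors intersect. The cost is the number of non-empty bins. In the online version, squares arrive one by one and each must be irrevocably placed (assigned to a bin at a position) before the next square is revealed. Online algorithms are deterministic. For an algorithm $A$ and input $I$, let $A(I)$ be its cost and $OPT(I)$ the minimum possible cost. Let $c(Q)=\max\{A(I): OPT(I)=Q\}$, and define the asymptotic competitive ratio as $R_A=\limsup_{Q\to\infty} c(Q)/Q$. *)

theory Defs
  imports "HOL-Analysis.Analysis"
begin

definition square_instance :: "real list \<Rightarrow> bool" where
  "square_instance I \<longleftrightarrow> set I \<subseteq> \<rat> \<inter> {0<..1}"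

text \<open>A placement is the index of a bin together with the position of the lower left corner
  of the square inside that bin; each bin has its own coordinate system, in which it is the
  square with corners (0, 0) and (1, 1).\<close>

type_synonym placement = "nat \<times> real \<times> real"

definition square_at :: "real \<times> real \<Rightarrow> real \<Rightarrow> (real \<times> real) set" where
  "square_at v s = cbox v (v + (s, s))"

definition overlap :: "(real \<times> real) set \<Rightarrow> (real \<times> real) set \<Rightarrow> bool" where
  "overlap S T \<longleftrightarrow> interior S \<inter> interior T \<noteq> {}"

text \<open>A packing of \<open>I\<close> maps each index \<open>i < length I\<close> to the placement of the \<open>i\<close>-th square;
  its values at other indices are irrelevant.\<close>

definition valid_packing :: "real list \<Rightarrow> (nat \<Rightarrow> placement) \<Rightarrow> bool" where
  "valid_packing I p \<longleftrightarrow>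
     (\<forall>i<length I. square_at (snd (p i)) (I ! i) \<subseteq> cbox (0, 0) (1, 1)) \<and>
     (\<forall>i<length I. \<forall>j<length I. i \<noteq> j \<and> fst (p i) = fst (p j) \<longrightarrow>
        \<not> overlap (square_at (snd (p i)) (I ! i)) (square_at (snd (p j)) (I ! j)))"

definition packing_cost :: "real list \<Rightarrow> (nat \<Rightarrow> placement) \<Rightarrow> nat" where
  "packing_cost I p = card ((\<lambda>i. fst (p i)) ` {..<length I})"

definition OPT :: "real list \<Rightarrow> nat" where
  "OPT I = (LEAST k. \<exists>p. valid_packing I p \<and> packing_cost I p = k)"

text \<open>A deterministic online algorithm is a function \<open>A\<close> that maps the nonempty sequence of
  squares revealed so far to the placement of its last square. The earlier placements need not be
  an argument of \<open>A\<close>, as they are determined by the shorter prefixes, and they cannot be revised,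
  as the placement of a square depends on nothing revealed after it.\<close>

definition online_packing :: "(real list \<Rightarrow> placement) \<Rightarrow> real list \<Rightarrow> nat \<Rightarrow> placement" where
  "online_packing A I i = A (take (Suc i) I)"

definition online_algorithm :: "(real list \<Rightarrow> placement) \<Rightarrow> bool" where
  "online_algorithm A \<longleftrightarrow> (\<forall>I. square_instance I \<longrightarrow> valid_packing I (online_packing A I))"

definition online_cost :: "(real list \<Rightarrow> placement) \<Rightarrow> real list \<Rightarrow> nat" where
  "online_cost A I = packing_cost I (online_packing A I)"

text \<open>The maximum of the costs over all inputs with optimum \<open>Q\<close> is taken in the extended reals:
  it is \<open>\<infinity>\<close> if these costs are unbounded.\<close>

definition worst_cost :: "(real list \<Rightarrow> placement) \<Rightarrow> nat \<Rightarrow> ereal" where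
  "worst_cost A Q = (SUP I \<in> {I. square_instance I \<and> OPT I = Q}. ereal (real (online_cost A I)))"

definition asymptotic_competitive_ratio :: "(real list \<Rightarrow> placement) \<Rightarrow> ereal" where
  "asymptotic_competitive_ratio A = limsup (\<lambda>Q. worst_cost A Q / ereal (real Q))"

lemma square_at_origin_subset:
  assumes "s \<le> 1"
  shows "square_at (0, 0) s \<subseteq> cbox (0, 0) (1, 1)"
  using assms unfolding square_at_def by (auto simp: cbox_Pair_eq)

lemma online_algorithm_exists: "\<exists>A. online_algorithm A"
proof
  show "online_algorithm (\<lambda>I. (length I, 0, 0))"
    unfolding online_algorithm_def valid_packing_def online_packing_def square_instance_def
    using square_at_origin_subset by (fastforce dest: nth_mem)
qed

lemma OPT_attained:
  assumes "square_instance I"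
  shows "\<exists>p. valid_packing I p \<and> packing_cost I p = OPT I"
  unfolding OPT_def
proof (rule LeastI_ex)
  show "\<exists>k p. valid_packing I p \<and> packing_cost I p = k"
    using assms online_algorithm_exists unfolding online_algorithm_def by blast
qed

end

theory Submission
  imports Defs
begin

text \<open>The adversary presents \<open>15 s\<close> squares of side slightly above 1/4 and then \<open>20 s\<close> squares of
  side slightly above 1/3. Within each group the sides are found by bisection: a square packed into
  an empty bin becomes larger, every other one smaller, than a threshold \<open>\<theta>\<close> for the group. Every
  bin opened for the group then contains a square of side above \<open>\<theta>\<close>, hence cannot receive a square
  of side \<open>1 - \<theta>\<close>, whereas an optimal packing combines the squares of side below \<open>\<theta>\<close> with
  squares of side \<open>1 - \<theta>\<close>. There are three continuations: squares of side just below 3/4 after the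
  first group, and squares of side just below 2/3, or of a fixed side between 1/2 and 2/3, after the
  second group. A square of side above 1/4 covers one of the 9 points with coordinates in
  \<open>{1/4, 1/2, 3/4}\<close>, one of side above 1/2 covers four of them, and one of side above 1/3 covers one
  of the 4 points with coordinates in \<open>{1/3, 2/3}\<close>. These capacities make it impossible for the
  algorithm to stay below 1.7515445 times the optimum in all three continuations.\<close>

subsection \<open>Squares in a bin\<close>

lemma interior_square_at: "interior (square_at (x, y) s) = {x<..<x + s} \<times> {y<..<y + s}"
  unfolding square_at_def by (simp add: cbox_Pair_eq interior_Times)

lemma square_at_subset_unit_iff:
  assumes "0 < s"
  shows "square_at (x, y) s \<subseteq> cbox (0, 0) (1, 1) \<longleftrightarrow> 0 \<le> x \<and> x + s \<le> 1 \<and> 0 \<le> y \<and> y + s \<le> 1"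
  using assms unfolding square_at_def by (simp add: cbox_Pair_eq times_subset_iff)

lemma not_overlap_if_separated:
  assumes "x + s \<le> x' \<or> x' + s' \<le> x \<or> y + s \<le> y' \<or> y' + s' \<le> y"
  shows "\<not> overlap (square_at (x, y) s) (square_at (x', y') s')"
  using assms unfolding overlap_def interior_square_at by auto

text \<open>On either axis the two projections are subintervals of [0, 1] of total length above 1,
  so their interiors meet.\<close>

lemma overlap_if_large:
  assumes "square_at v s \<subseteq> cbox (0, 0) (1, 1)" "square_at w t \<subseteq> cbox (0, 0) (1, 1)"
    and "0 < s" "0 < t" "1 < s + t"
  shows "overlap (square_at v s) (square_at w t)"
proof -
  obtain x y x' y' where vw: "v = (x, y)" "w = (x', y')" by fastforce
  have *: "\<exists>z. x < z \<and> z < x + s \<and> x' < z \<and> z < x' + t"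
    if "0 \<le> x" "x + s \<le> 1" "0 \<le> x'" "x' + t \<le> 1" for x x' :: real
    using that assms(3-5) by (intro exI[of _ "(max x x' + min (x + s) (x' + t)) / 2"]) auto
  have "\<exists>z. z \<in> {x<..<x + s} \<inter> {x'<..<x' + t}" "\<exists>z. z \<in> {y<..<y + s} \<inter> {y'<..<y' + t}"
    using assms *[of x x'] *[of y y'] by (auto simp: square_at_subset_unit_iff vw)
  then show ?thesis
    unfolding overlap_def vw interior_square_at Times_Int_Times by blast
qed

subsection \<open>Offline packings\<close>

text \<open>Restricting to an index set \<open>J\<close> lets a packing be assembled from parts, and
  numbering the bins below \<open>k\<close> gives bounds that add up.\<close>

definition packs :: "real list \<Rightarrow> nat set \<Rightarrow> nat \<Rightarrow> bool" where
  "packs I J k \<longleftrightarrow> (\<exists>p :: nat \<Rightarrow> placement.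
     (\<forall>i\<in>J. fst (p i) < k \<and> square_at (snd (p i)) (I ! i) \<subseteq> cbox (0, 0) (1, 1)) \<and>
     (\<forall>i\<in>J. \<forall>j\<in>J. i \<noteq> j \<and> fst (p i) = fst (p j) \<longrightarrow>
        \<not> overlap (square_at (snd (p i)) (I ! i)) (square_at (snd (p j)) (I ! j))))"

lemma OPT_le_if_packs:
  assumes "packs I {..<length I} k"
  shows "OPT I \<le> k"
proof -
  obtain p where p: "\<forall>i<length I. fst (p i) < k" "valid_packing I p"
    using assms unfolding packs_def valid_packing_def lessThan_iff by blast
  have "packing_cost I p \<le> card {..<k}"
    unfolding packing_cost_def by (rule card_mono) (use p(1) in auto)
  moreover have "OPT I \<le> packing_cost I p"
    unfolding OPT_def by (rule Least_le) (use p(2) in blast)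
  ultimately show ?thesis by simp
qed

lemma packs_union:
  assumes "packs I J k" "packs I J' k'"
  shows "packs I (J \<union> J') (k + k')"
proof -
  obtain p where p: "\<And>i. i \<in> J \<Longrightarrow> fst (p i) < k" "\<And>i. i \<in> J \<Longrightarrow> square_at (snd (p i)) (I ! i) \<subseteq> cbox (0, 0) (1, 1)"
      "\<And>i j. i \<in> J \<Longrightarrow> j \<in> J \<Longrightarrow> i \<noteq> j \<Longrightarrow> fst (p i) = fst (p j) \<Longrightarrow>
        \<not> overlap (square_at (snd (p i)) (I ! i)) (square_at (snd (p j)) (I ! j))"
    using assms(1) unfolding packs_def by blast
  obtain p' where p': "\<And>i. i \<in> J' \<Longrightarrow> fst (p' i) < k'" "\<And>i. i \<in> J' \<Longrightarrow> square_at (snd (p' i)) (I ! i) \<subseteq> cbox (0, 0) (1, 1)"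
      "\<And>i j. i \<in> J' \<Longrightarrow> j \<in> J' \<Longrightarrow> i \<noteq> j \<Longrightarrow> fst (p' i) = fst (p' j) \<Longrightarrow>
        \<not> overlap (square_at (snd (p' i)) (I ! i)) (square_at (snd (p' j)) (I ! j))"
    using assms(2) unfolding packs_def by blast
  \<comment> \<open>The shift by \<open>k\<close> keeps the bins of the two packings apart; an index
    in both sets keeps its placement from \<open>p\<close>.\<close>
  define r where "r i = (if i \<in> J then p i else (k + fst (p' i), snd (p' i)))" for i
  show ?thesis
    unfolding packs_def
  proof (intro exI[of _ r] conjI ballI impI)
    fix i assume "i \<in> J \<union> J'"
    then show "fst (r i) < k + k'" "square_at (snd (r i)) (I ! i) \<subseteq> cbox (0, 0) (1, 1)"
      using p(1,2)[of i] p'(1,2)[of i] by (auto simp: r_def)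
  next
    fix i j assume "i \<in> J \<union> J'" "j \<in> J \<union> J'" "i \<noteq> j \<and> fst (r i) = fst (r j)"
    then show "\<not> overlap (square_at (snd (r i)) (I ! i)) (square_at (snd (r j)) (I ! j))"
      using p(1)[of i] p(1)[of j] p(3)[of i j] p'(3)[of i j] by (auto simp: r_def split: if_splits)
  qed
qed

lemma exists_injection:
  assumes "finite J" "finite T" "card J \<le> card T"
  obtains f where "inj_on f J" "\<And>i. i \<in> J \<Longrightarrow> f i \<in> T"
  using card_le_inj[OF assms] by blast

text \<open>The lines at coordinates \<open>u\<close> and \<open>1 - u\<close> cut a bin into a \<open>3 \<times> 3\<close> grid, whose cells
  \<open>T\<close> are used in all \<open>k\<close> bins; the cells \<open>R\<close> are corner cells. A square from \<open>JC\<close> covers the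
  four lower left cells.\<close>

lemma packs_grid:
  fixes I :: "real list" and T R :: "(nat \<times> nat) set"
  assumes u: "0 < u" "u < 1/2"
    and T: "T \<subseteq> {..2} \<times> {..2}" "R \<subseteq> T" "R \<subseteq> {0, 2} \<times> {0, 2}"
    and fin: "finite JA" "finite JB" "finite JC"
    and disj: "JA \<inter> JB = {}" "JA \<inter> JC = {}" "JB \<inter> JC = {}"
    and C: "JC = {} \<or> T \<subseteq> {(x, y). x = 2 \<or> y = 2}"
    and card: "card JC \<le> k" "card JB \<le> k * card R" "card JA + card JB \<le> k * card T"
    and A_size: "\<And>i. i \<in> JA \<Longrightarrow> 0 < I ! i \<and> I ! i \<le> u \<and> I ! i \<le> 1 - 2 * u"
    and B_size: "\<And>i. i \<in> JB \<Longrightarrow> 0 < I ! i \<and> I ! i \<le> u"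
    and C_size: "\<And>i. i \<in> JC \<Longrightarrow> 0 < I ! i \<and> I ! i \<le> 1 - u"
  shows "packs I (JA \<union> JB \<union> JC) k"
proof -
  have finT: "finite T" "finite R"
    using T by (meson finite_SigmaI finite_atMost finite_subset)+
  \<comment> \<open>Squares from \<open>JB\<close> choose distinct corner cells first; those from
    \<open>JA\<close> get distinct cells among what remains of \<open>T\<close>.\<close>
  obtain fB where fB: "inj_on fB JB" "\<And>i. i \<in> JB \<Longrightarrow> fB i \<in> {..<k} \<times> R"
    using exists_injection[of JB "{..<k} \<times> R"] fin finT card by (auto simp: card_cartesian_product)
  have sub: "fB ` JB \<subseteq> {..<k} \<times> T" using fB(2) T(2) by fastforce
  have "card ({..<k} \<times> T - fB ` JB) = k * card T - card JB"
    using sub fin finT fB(1) by (simp add: card_Diff_subset card_cartesian_product card_image)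
  then have "card JA \<le> card ({..<k} \<times> T - fB ` JB)" using card(3) by simp
  then obtain fA where fA: "inj_on fA JA" "\<And>i. i \<in> JA \<Longrightarrow> fA i \<in> {..<k} \<times> T - fB ` JB"
    using exists_injection[of JA "{..<k} \<times> T - fB ` JB"] fin finT by blast
  obtain fC where fC: "inj_on fC JC" "\<And>i. i \<in> JC \<Longrightarrow> fC i \<in> {..<k}"
    using exists_injection[of JC "{..<k}"] fin card by auto
  define f where "f i = (if i \<in> JA then fA i else fB i)" for i
  have f_inj: "inj_on f (JA \<union> JB)"
  proof (rule inj_onI)
    fix i j assume "i \<in> JA \<union> JB" "j \<in> JA \<union> JB" "f i = f j"
    then show "i = j"
      using fA(2)[of i] fA(2)[of j] inj_onD[OF fA(1), of i j] inj_onD[OF fB(1), of i j]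
      by (cases "i \<in> JA"; cases "j \<in> JA") (auto simp: f_def image_iff)
  qed
  have fT: "f i \<in> {..<k} \<times> T" if "i \<in> JA \<union> JB" for i
    using that fA(2)[of i] sub by (auto simp: f_def)
  have fR: "f i \<in> {..<k} \<times> R" if "i \<in> JB" for i
    using that fB(2)[of i] disj by (auto simp: f_def)
  \<comment> \<open>Lower end of a column or row; the widths are \<open>u\<close>,
    \<open>1 - 2 * u\<close> and \<open>u\<close>. The bound \<open>1 - 2 * u\<close> matters only
    in the middle, so corner cells take every side up to \<open>u\<close>.\<close>
  define pos :: "nat \<Rightarrow> real" where "pos x = (if x = 0 then 0 else if x = 1 then u else 1 - u)" for x
  define p :: "nat \<Rightarrow> placement" where
    "p i = (if i \<in> JC then (fC i, 0, 0)
            else (fst (f i), pos (fst (snd (f i))), pos (snd (snd (f i)))))" for i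
  have pos_next: "pos x + s \<le> pos x'"
    if "x < x'" "x' \<le> 2" "s \<le> u" "s \<le> 1 - 2 * u \<or> x \<in> {0, 2}" for x x' s
    using that u by (auto simp: pos_def)
  have pos_range: "0 \<le> pos x" "s \<le> u \<Longrightarrow> x \<le> 2 \<Longrightarrow> pos x + s \<le> 1" for x s
    using u by (auto simp: pos_def)
  have cell: "\<exists>q x y. f i = (q, x, y) \<and> q < k \<and> x \<le> 2 \<and> y \<le> 2 \<and> 0 < I ! i \<and> I ! i \<le> u \<and>
      (I ! i \<le> 1 - 2 * u \<or> x \<in> {0, 2} \<and> y \<in> {0, 2}) \<and> i \<notin> JC \<and> (JC = {} \<or> x = 2 \<or> y = 2)"
    if "i \<in> JA \<union> JB" for i
  proof -
    obtain q x y where q: "f i = (q, x, y)" using prod_cases3 by blast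
    moreover have "(x, y) \<in> T" "q < k" using fT[OF that] q by auto
    moreover have "i \<in> JB \<Longrightarrow> (x, y) \<in> R" using fR[of i] q by auto
    moreover have "i \<notin> JC" using that disj by blast
    moreover have "0 < I ! i \<and> I ! i \<le> u" "I ! i \<le> 1 - 2 * u \<or> i \<in> JB"
      using that A_size B_size by auto
    moreover have "JC = {} \<or> x = 2 \<or> y = 2" "x \<le> 2" "y \<le> 2" "i \<in> JB \<Longrightarrow> x \<in> {0, 2} \<and> y \<in> {0, 2}"
      using calculation(2,4) T C by auto
    ultimately show ?thesis by blast
  qed
  show ?thesis
    unfolding packs_def
  proof (intro exI[of _ p] conjI ballI impI)
    fix i assume i: "i \<in> JA \<union> JB \<union> JC"
    show "fst (p i) < k"
      using i fC(2)[of i] cell[of i] by (auto simp: p_def)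
    show "square_at (snd (p i)) (I ! i) \<subseteq> cbox (0, 0) (1, 1)"
    proof (cases "i \<in> JC")
      case True
      then show ?thesis using C_size[of i] u by (auto simp: p_def square_at_subset_unit_iff)
    next
      case False
      then obtain q x y where q: "f i = (q, x, y)" "x \<le> 2" "y \<le> 2" "0 < I ! i" "I ! i \<le> u"
        using i cell[of i] by blast
      then have "square_at (pos x, pos y) (I ! i) \<subseteq> cbox (0, 0) (1, 1)"
        using pos_range(1) pos_range(2)[of "I ! i"] by (simp add: square_at_subset_unit_iff)
      then show ?thesis using False q by (simp add: p_def)
    qed
  next
    fix i j assume i: "i \<in> JA \<union> JB \<union> JC" and j: "j \<in> JA \<union> JB \<union> JC"
      and ij: "i \<noteq> j \<and> fst (p i) = fst (p j)"
    have CC: False if "i \<in> JC" "j \<in> JC" using that ij fC(1) by (auto simp: p_def inj_on_def)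
    have C_AB: "\<not> overlap (square_at (snd (p i)) (I ! i)) (square_at (snd (p j)) (I ! j))"
      if ij': "i \<in> JC" "j \<in> JA \<union> JB" for i j
    proof -
      obtain q x y where q: "f j = (q, x, y)" "j \<notin> JC" "x = 2 \<or> y = 2"
        using cell[OF ij'(2)] ij'(1) by blast
      show ?thesis
        using q C_size[OF ij'(1)] ij'(1)
        by (simp add: p_def) (rule not_overlap_if_separated, auto simp: pos_def)
    qed
    have AB: "\<not> overlap (square_at (snd (p i)) (I ! i)) (square_at (snd (p j)) (I ! j))"
      if ij': "i \<in> JA \<union> JB" "j \<in> JA \<union> JB"
    proof -
      obtain q x y where q: "f i = (q, x, y)" "i \<notin> JC" "x \<le> 2" "y \<le> 2" "I ! i \<le> u"
          "I ! i \<le> 1 - 2 * u \<or> x \<in> {0, 2} \<and> y \<in> {0, 2}"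
        using cell[OF ij'(1)] by blast
      obtain q' x' y' where q': "f j = (q', x', y')" "j \<notin> JC" "x' \<le> 2" "y' \<le> 2" "I ! j \<le> u"
          "I ! j \<le> 1 - 2 * u \<or> x' \<in> {0, 2} \<and> y' \<in> {0, 2}"
        using cell[OF ij'(2)] by blast
      \<comment> \<open>Distinct cells of one bin differ in a coordinate, and along it the square in
        the lower cell ends no later than the other one starts.\<close>
      have "q = q'" using ij q q' by (simp add: p_def)
      moreover have "f i \<noteq> f j" using f_inj ij ij' by (auto simp: inj_on_def)
      ultimately consider "x < x'" | "x' < x" | "y < y'" | "y' < y"
        using q(1) q'(1) by (metis nat_neq_iff)
      then have "pos x + I ! i \<le> pos x' \<or> pos x' + I ! j \<le> pos x \<or>
          pos y + I ! i \<le> pos y' \<or> pos y' + I ! j \<le> pos y"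
        using pos_next[of x x' "I ! i"] pos_next[of x' x "I ! j"]
          pos_next[of y y' "I ! i"] pos_next[of y' y "I ! j"] q(3-6) q'(3-6)
        by cases blast+
      then show ?thesis using q q' by (simp add: p_def not_overlap_if_separated)
    qed
    have sym: "overlap S S' \<longleftrightarrow> overlap S' S" for S S' by (auto simp: overlap_def)
    show "\<not> overlap (square_at (snd (p i)) (I ! i)) (square_at (snd (p j)) (I ! j))"
      using i j CC C_AB[of i j] C_AB[of j i] AB sym by blast
  qed
qed

subsection \<open>Capacity of a bin\<close>

lemma valid_packing_position:
  assumes "valid_packing I p" "i < length I" "0 < I ! i" "snd (p i) = (x, y)"
  shows "0 \<le> x \<and> x + I ! i \<le> 1 \<and> 0 \<le> y \<and> y + I ! i \<le> 1"
  using assms(1,2) square_at_subset_unit_iff[OF assms(3)] assms(4)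
  unfolding valid_packing_def by metis

text \<open>Squares in one bin have disjoint interiors, so each point of \<open>G\<close> is counted
  at most once.\<close>

lemma sum_grid_points_le:
  assumes "valid_packing I p" "finite G"
    and Q: "Q \<subseteq> {i. i < length I \<and> fst (p i) = q}"
    and w: "\<And>i. i \<in> Q \<Longrightarrow> w i \<le> card (G \<inter> interior (square_at (snd (p i)) (I ! i)))"
  shows "(\<Sum>i\<in>Q. w i) \<le> card G"
proof -
  let ?S = "\<lambda>i. G \<inter> interior (square_at (snd (p i)) (I ! i))"
  have "finite Q" using Q finite_subset by fastforce
  have "(\<Sum>i\<in>Q. w i) \<le> (\<Sum>i\<in>Q. card (?S i))" using w by (rule sum_mono)
  also have "\<dots> = card (\<Union>i\<in>Q. ?S i)"
  proof (rule card_UN_disjoint[symmetric])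
    show "\<forall>i\<in>Q. \<forall>j\<in>Q. i \<noteq> j \<longrightarrow> ?S i \<inter> ?S j = {}"
      using assms(1) Q unfolding valid_packing_def overlap_def by blast
  qed (use assms \<open>finite Q\<close> in auto)
  also have "\<dots> \<le> card G" using assms(2) by (intro card_mono) auto
  finally show ?thesis .
qed

text \<open>The three points leave gaps of length 1/4 in [0, 1]. An interval longer than 1/2
  contains 1/2 and reaches beyond 1/4 or 3/4.\<close>

lemma card_quarters:
  fixes v s :: real
  assumes "0 \<le> v" "v + s \<le> 1" "1/4 < s"
  shows "(if 1/2 < s then 2 else 1) \<le> card ({1/4, 1/2, 3/4} \<inter> {v<..<v + s})"
proof -
  let ?S = "{1/4, 1/2, 3/4} \<inter> {v<..<v + s}"
  have card2: "2 \<le> card ?S" if "{x, y} \<subseteq> ?S" "x \<noteq> y" for x y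
    using card_mono[OF _ that(1)] that(2) by simp
  have card1: "1 \<le> card ?S" if "x \<in> ?S" for x
    using that card_gt_0_iff[of ?S] by auto
  show ?thesis
  proof (cases "1/2 < s")
    case True
    then have "{1/4, 1/2} \<subseteq> ?S \<or> {1/2, 3/4} \<subseteq> ?S" using assms by auto
    then have "2 \<le> card ?S" using card2[of "1/4" "1/2"] card2[of "1/2" "3/4"] by auto
    then show ?thesis using True by simp
  next
    case False
    then have "1/4 \<in> ?S \<or> 1/2 \<in> ?S \<or> 3/4 \<in> ?S" using assms by auto
    then have "1 \<le> card ?S" using card1 by blast
    then show ?thesis using False by simp
  qed
qed

text \<open>The left side is a sum of weights, 4 for a side above 1/2 and 1 otherwise. The weight is
  the product of the numbers of grid coordinates that the two projections must contain.\<close>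

lemma bin_capacity_quarter:
  assumes "valid_packing I p" "Q \<subseteq> {i. i < length I \<and> fst (p i) = q}"
    and "\<And>i. i \<in> Q \<Longrightarrow> 1/4 < I ! i"
  shows "card Q + 3 * card {i \<in> Q. 1/2 < I ! i} \<le> 9"
proof -
  let ?G = "{1/4, 1/2, 3/4 :: real}"
  have finQ: "finite Q" using assms(2) finite_subset by fastforce
  have "(\<Sum>i\<in>Q. if 1/2 < I ! i then 4 else 1) \<le> card (?G \<times> ?G)"
  proof (rule sum_grid_points_le[OF assms(1) _ assms(2)])
    fix i assume i: "i \<in> Q"
    obtain x y where xy: "snd (p i) = (x, y)" by fastforce
    let ?m = "if 1/2 < I ! i then 2 else 1 :: nat"
    have "0 \<le> x" "x + I ! i \<le> 1" "0 \<le> y" "y + I ! i \<le> 1"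
      using valid_packing_position[OF assms(1) _ _ xy] assms(2) assms(3)[OF i] i by auto
    then have "?m \<le> card (?G \<inter> {x<..<x + I ! i})" "?m \<le> card (?G \<inter> {y<..<y + I ! i})"
      using card_quarters assms(3)[OF i] by simp_all
    then have "?m * ?m \<le> card ((?G \<inter> {x<..<x + I ! i}) \<times> (?G \<inter> {y<..<y + I ! i}))"
      unfolding card_cartesian_product by (rule mult_le_mono)
    then show "(if 1/2 < I ! i then 4 else 1)
        \<le> card (?G \<times> ?G \<inter> interior (square_at (snd (p i)) (I ! i)))"
      unfolding xy interior_square_at Times_Int_Times by (simp only: split: if_splits) simp_all
  qed simp
  also have "(\<Sum>i\<in>Q. if 1/2 < I ! i then 4 else 1 :: nat) = (\<Sum>i\<in>Q. 1 + (if 1/2 < I ! i then 3 else 0))"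
    by (rule sum.cong) auto
  also have "\<dots> = card Q + 3 * card {i \<in> Q. 1/2 < I ! i}"
    unfolding sum.distrib sum.inter_filter[OF finQ, symmetric] by simp
  finally show ?thesis by (simp add: card_cartesian_product)
qed

lemma bin_capacity_third:
  assumes "valid_packing I p" "Q \<subseteq> {i. i < length I \<and> fst (p i) = q}"
    and "\<And>i. i \<in> Q \<Longrightarrow> 1/3 < I ! i"
  shows "card Q \<le> 4"
proof -
  let ?G = "{1/3, 2/3 :: real}"
  have "(\<Sum>i\<in>Q. 1) \<le> card (?G \<times> ?G)"
  proof (rule sum_grid_points_le[OF assms(1) _ assms(2)])
    fix i assume i: "i \<in> Q"
    obtain x y where xy: "snd (p i) = (x, y)" by fastforce
    have hit: "?G \<inter> {z<..<z + I ! i} \<noteq> {}" if "0 \<le> z" "z + I ! i \<le> 1" for z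
    proof -
      have "1/3 \<in> {z<..<z + I ! i} \<or> 2/3 \<in> {z<..<z + I ! i}"
        using that assms(3)[OF i] by auto
      then show ?thesis by blast
    qed
    have "0 \<le> x" "x + I ! i \<le> 1" "0 \<le> y" "y + I ! i \<le> 1"
      using valid_packing_position[OF assms(1) _ _ xy] assms(2) assms(3)[OF i] i by auto
    then have "(?G \<inter> {x<..<x + I ! i}) \<times> (?G \<inter> {y<..<y + I ! i}) \<noteq> {}"
      using hit[of x] hit[of y] by (simp only: Sigma_empty_iff) blast
    then have "0 < card ((?G \<inter> {x<..<x + I ! i}) \<times> (?G \<inter> {y<..<y + I ! i}))"
      by (simp add: card_gt_0_iff)
    then show "1 \<le> card (?G \<times> ?G \<inter> interior (square_at (snd (p i)) (I ! i)))"
      unfolding xy interior_square_at Times_Int_Times by (simp only: One_nat_def Suc_le_eq)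
  qed simp
  then show ?thesis by (simp add: card_cartesian_product)
qed

subsection \<open>Cost of online algorithms\<close>

lemma valid_packing_unit:
  assumes "valid_packing I p" "i < length I"
  shows "square_at (snd (p i)) (I ! i) \<subseteq> cbox (0, 0) (1, 1)"
  using assms unfolding valid_packing_def by blast

lemma sides_in_same_bin:
  assumes valid: "valid_packing I p" and "i < length I" "j < length I" "i \<noteq> j" "fst (p i) = fst (p j)"
    and "0 < I ! i" "0 < I ! j"
  shows "I ! i + I ! j \<le> 1"
proof (rule ccontr)
  assume "\<not> I ! i + I ! j \<le> 1"
  then have "overlap (square_at (snd (p i)) (I ! i)) (square_at (snd (p j)) (I ! j))"
    using assms by (intro overlap_if_large valid_packing_unit) auto
  then show False using assms unfolding valid_packing_def by blast
qed

text \<open>The square \<open>m\<close> takes at least four of the nine points and one of the four.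
  The remaining 5 and 3 reappear in \<open>open_bins\<close>.\<close>

lemma bin_capacity_beside_half:
  assumes valid: "valid_packing I p" and m: "m < length I" "1/2 < I ! m"
    and Q: "Q \<subseteq> {i. i < length I \<and> fst (p i) = fst (p m)}" "m \<notin> Q"
  shows "(\<And>i. i \<in> Q \<Longrightarrow> 1/4 < I ! i) \<Longrightarrow> card Q \<le> 5"
    and "(\<And>i. i \<in> Q \<Longrightarrow> 1/3 < I ! i) \<Longrightarrow> card Q \<le> 3"
proof -
  have fin: "finite Q" using Q(1) finite_subset by fastforce
  have sub: "insert m Q \<subseteq> {i. i < length I \<and> fst (p i) = fst (p m)}" using Q(1) m(1) by auto
  have card: "card (insert m Q) = Suc (card Q)" using fin Q(2) by simp
  have "card {m} \<le> card {i \<in> insert m Q. 1/2 < I ! i}"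
    using m(2) fin by (intro card_mono) auto
  moreover assume "\<And>i. i \<in> Q \<Longrightarrow> 1/4 < I ! i"
  then have "card (insert m Q) + 3 * card {i \<in> insert m Q. 1/2 < I ! i} \<le> 9"
    using m(2) by (intro bin_capacity_quarter[OF valid sub]) auto
  ultimately show "card Q \<le> 5" using card by simp
next
  have fin: "finite Q" using Q(1) finite_subset by fastforce
  have sub: "insert m Q \<subseteq> {i. i < length I \<and> fst (p i) = fst (p m)}" using Q(1) m(1) by auto
  assume "\<And>i. i \<in> Q \<Longrightarrow> 1/3 < I ! i"
  then have "card (insert m Q) \<le> 4"
    using m(2) by (intro bin_capacity_third[OF valid sub]) auto
  then show "card Q \<le> 3" using fin Q(2) by simp
qed

lemma length_le_packing_cost:
  assumes "valid_packing I p" "\<And>i. i < length I \<Longrightarrow> 1/4 < I ! i"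
  shows "length I \<le> 9 * packing_cost I p"
proof -
  let ?f = "\<lambda>i. fst (p i)"
  have "length I = (\<Sum>q\<in>?f ` {..<length I}. card {i \<in> {..<length I}. ?f i = q})"
    using sum.image_gen[of "{..<length I}" "\<lambda>_. 1::nat" ?f] by simp
  also have "\<dots> \<le> (\<Sum>q\<in>?f ` {..<length I}. 9)"
    using bin_capacity_quarter[OF assms(1)] assms(2)
    by (intro sum_mono) (smt (verit) add_leD1 lessThan_iff mem_Collect_eq subsetI)
  finally show ?thesis by (simp add: packing_cost_def)
qed

text \<open>This forces the optimum of the adversary's inputs to grow with their length.\<close>

lemma length_le_OPT:
  assumes "square_instance I" "\<And>i. i < length I \<Longrightarrow> 1/4 < I ! i"
  shows "length I \<le> 9 * OPT I"
  using OPT_attained[OF assms(1)] length_le_packing_cost[OF _ assms(2)] by metis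

text \<open>Squares of side above 1/2 never share a bin, so the copies occupy \<open>M\<close> bins,
  of which only those in \<open>P\<close> may already be used by \<open>J\<close>.\<close>

lemma packing_cost_append_replicate:
  assumes valid: "valid_packing (J @ replicate M c) p" and "1/2 < c" and "finite P"
    and P: "\<And>i m. i < length J \<Longrightarrow> length J \<le> m \<Longrightarrow> m < length J + M \<Longrightarrow>
      fst (p i) = fst (p m) \<Longrightarrow> fst (p i) \<in> P"
  shows "packing_cost J p + M \<le> packing_cost (J @ replicate M c) p + card P"
proof -
  let ?f = "\<lambda>i. fst (p i)" and ?C = "{length J..<length J + M}" and ?I = "J @ replicate M c"
  have inj: "inj_on ?f ?C"
  proof (rule inj_onI, rule ccontr)
    fix i j assume i: "i \<in> ?C" "j \<in> ?C" "?f i = ?f j" "i \<noteq> j"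
    have "?I ! i = c" "?I ! j = c" using i(1,2) by (auto simp: nth_append)
    then show False using sides_in_same_bin[OF valid _ _ i(4,3)] i(1,2) \<open>1/2 < c\<close> by simp
  qed
  have "card (?f ` {..<length J}) + card (?f ` ?C)
      = card (?f ` {..<length J} \<union> ?f ` ?C) + card (?f ` {..<length J} \<inter> ?f ` ?C)"
    by (rule card_Un_Int) auto
  moreover have "card (?f ` {..<length J} \<inter> ?f ` ?C) \<le> card P"
    using P \<open>finite P\<close> by (intro card_mono) auto
  moreover have "?f ` {..<length J} \<union> ?f ` ?C = ?f ` {..<length ?I}"
    by (simp add: ivl_disj_un lessThan_atLeast0 flip: image_Un)
  ultimately show ?thesis
    using card_image[OF inj] by (simp add: packing_cost_def)
qed

lemma online_packing_append:
  assumes "i < length J"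
  shows "online_packing A (J @ X) i = online_packing A J i"
  using assms by (simp add: online_packing_def)

text \<open>Each new value has exactly one first occurrence. With \<open>f\<close> the bin of a
  square, squares that open a bin are counted by the bins they open.\<close>

lemma card_first_occurrences:
  fixes f :: "nat \<Rightarrow> 'a"
  assumes "m \<le> n"
  shows "card {i. m \<le> i \<and> i < n \<and> f i \<notin> f ` {..<i}} = card (f ` {..<n} - f ` {..<m})"
  using assms
proof (induction n rule: dec_induct)
  case base
  have "{i. m \<le> i \<and> i < m \<and> f i \<notin> f ` {..<i}} = {}" by auto
  then show ?case by simp
next
  case (step n)
  let ?S = "\<lambda>n. {i. m \<le> i \<and> i < n \<and> f i \<notin> f ` {..<i}}"
  have fin: "finite (?S n)" by (rule finite_subset[of _ "{..<n}"]) auto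
  have sub: "f ` {..<m} \<subseteq> f ` {..<n}" using step.hyps by auto
  show ?case
  proof (cases "f n \<in> f ` {..<n}")
    case True
    then have "?S (Suc n) = ?S n" by (auto simp: less_Suc_eq)
    then show ?thesis using step.IH True by (simp add: lessThan_Suc insert_absorb)
  next
    case False
    then have "?S (Suc n) = insert n (?S n)" using step.hyps by (auto simp: less_Suc_eq)
    moreover have "f ` {..<Suc n} - f ` {..<m} = insert (f n) (f ` {..<n} - f ` {..<m})"
      using False sub by (auto simp: lessThan_Suc)
    ultimately show ?thesis using step.IH False fin by simp
  qed
qed

lemma first_occurrence:
  fixes f :: "nat \<Rightarrow> 'a"
  assumes "q \<in> f ` {..<n} - f ` {..<m}"
  obtains i where "m \<le> i" "i < n" "f i = q" "f i \<notin> f ` {..<i}"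
proof -
  define i where "i = (LEAST i. f i = q)"
  obtain j where j: "j < n" "f j = q" using assms by auto
  have "f i = q" "i \<le> j" unfolding i_def using j(2) by (auto intro: LeastI Least_le)
  moreover have "f l \<noteq> q" if "l < i" for l using that not_less_Least unfolding i_def by blast
  moreover have "m \<le> i" using \<open>f i = q\<close> assms by (auto simp: not_less[symmetric])
  ultimately show thesis using j(1) by (intro that[of i]) fastforce+
qed

subsection \<open>The adversary\<close>

definition opens_bin :: "(real list \<Rightarrow> placement) \<Rightarrow> real list \<Rightarrow> bool" where
  "opens_bin A L \<longleftrightarrow> fst (A L) \<notin> (\<lambda>i. fst (online_packing A L i)) ` {..<length L - 1}"

text \<open>Placements depend only on the prefix, so the reaction seen by the adversary can be read
  off the final packing.\<close>

lemma opens_bin_take_iff: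
  assumes "i < length I"
  shows "opens_bin A (take (Suc i) I) \<longleftrightarrow>
    fst (online_packing A I i) \<notin> (\<lambda>i. fst (online_packing A I i)) ` {..<i}"
proof -
  have "(\<lambda>j. fst (online_packing A (take (Suc i) I) j)) ` {..<i}
      = (\<lambda>j. fst (online_packing A I j)) ` {..<i}"
    by (rule image_cong) (auto simp: online_packing_def min_def)
  then show ?thesis
    using assms by (simp add: opens_bin_def online_packing_def min.absorb2)
qed

text \<open>Bisection: each item is the midpoint of the current interval, and the algorithm's reaction
  \<open>P\<close> determines on which side of it all later items and the threshold lie.\<close>

lemma adaptive_items:
  fixes l h :: real and P :: "real list \<Rightarrow> bool"
  assumes "l < h" "l \<in> \<rat>" "h \<in> \<rat>"
  shows "\<exists>xs \<theta>. length xs = n \<and> set xs \<subseteq> \<rat> \<inter> {l<..<h} \<and> \<theta> \<in> \<rat> \<inter> {l<..<h} \<and>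
    (\<forall>i<n. if P (I @ take (Suc i) xs) then \<theta> < xs ! i else xs ! i < \<theta>)"
  using assms
proof (induction n arbitrary: l h I)
  case 0
  then show ?case by (intro exI[of _ "[]"] exI[of _ "(l + h) / 2"]) auto
next
  case (Suc n)
  define x where "x = (l + h) / 2"
  have x: "l < x" "x < h" "x \<in> \<rat>" using Suc.prems by (auto simp: x_def)
  \<comment> \<open>If \<open>P\<close> holds, \<open>x\<close> has to exceed the threshold, so the
    search continues below \<open>x\<close>; otherwise above it.\<close>
  define l' h' where "l' = (if P (I @ [x]) then l else x)" and "h' = (if P (I @ [x]) then x else h)"
  have lh: "l' < h'" "l' \<in> \<rat>" "h' \<in> \<rat>" "l \<le> l'" "h' \<le> h"
    using Suc.prems x by (auto simp: l'_def h'_def)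
  obtain xs \<theta> where xs: "length xs = n" "set xs \<subseteq> \<rat> \<inter> {l'<..<h'}" "\<theta> \<in> \<rat> \<inter> {l'<..<h'}"
      "\<forall>i<n. if P ((I @ [x]) @ take (Suc i) xs) then \<theta> < xs ! i else xs ! i < \<theta>"
    using Suc.IH[of l' h' "I @ [x]"] lh by blast
  have "if P (I @ take (Suc i) (x # xs)) then \<theta> < (x # xs) ! i else (x # xs) ! i < \<theta>"
    if "i < Suc n" for i
  proof (cases i)
    case 0
    then show ?thesis using xs(3) by (auto simp: l'_def h'_def)
  next
    case (Suc j)
    then show ?thesis using xs(4) that by simp
  qed
  moreover have "{l'<..<h'} \<subseteq> {l<..<h}" using lh by auto
  ultimately show ?case
    using xs x by (intro exI[of _ "x # xs"] exI[of _ \<theta>]) auto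
qed

lemma ratio_geI:
  assumes "\<And>K. \<exists>I. square_instance I \<and> K \<le> OPT I \<and> r * real (OPT I) \<le> real (online_cost A I)"
  shows "ereal r \<le> asymptotic_competitive_ratio A"
  unfolding asymptotic_competitive_ratio_def limsup_INF_SUP
proof (rule INF_greatest)
  fix K
  \<comment> \<open>Asking for \<open>Suc K\<close> makes the optimum positive, so that it can be
    divided by.\<close>
  obtain I where I: "square_instance I" "Suc K \<le> OPT I" "r * real (OPT I) \<le> real (online_cost A I)"
    using assms by blast
  have "ereal r \<le> ereal (real (online_cost A I)) / ereal (real (OPT I))"
  proof -
    have "0 < OPT I" using I(2) by simp
    then show ?thesis using I(3) by (simp add: pos_le_divide_eq)
  qed
  also have "\<dots> \<le> worst_cost A (OPT I) / ereal (real (OPT I))"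
    unfolding worst_cost_def using I(1,2) by (intro ereal_divide_right_mono SUP_upper) auto
  also have "\<dots> \<le> (SUP m\<in>{K..}. worst_cost A m / ereal (real m))"
    using I(2) by (intro SUP_upper) auto
  finally show "ereal r \<le> (SUP m\<in>{K..}. worst_cost A m / ereal (real m))" .
qed

text \<open>A square is large if the algorithm packs it into an empty bin. \<open>LA\<close> and \<open>LB\<close> are the
  indices of the large squares of \<open>X\<close> and \<open>Y\<close>; \<open>DA\<close> and \<open>DB\<close> are the bins they open;
  \<open>open_bins\<close> are the bins that the bounds of 9 and 4 on their contents still allow to receive a
  square of side above 1/2.\<close>

locale adversary =
  fixes A :: "real list \<Rightarrow> placement" and X Y :: "real list" and \<theta>A \<theta>B :: real and s :: nat
  assumes alg: "online_algorithm A"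
    and X: "length X = 15 * s" "set X \<subseteq> \<rat> \<inter> {1/4<..<5/18}"
    and Y: "length Y = 20 * s" "set Y \<subseteq> \<rat> \<inter> {1/3<..<13/36}"
    and \<theta>A: "\<theta>A \<in> \<rat> \<inter> {1/4<..<5/18}"
    and \<theta>B: "\<theta>B \<in> \<rat> \<inter> {1/3<..<13/36}"
    and X_adaptive: "\<And>i. i < 15 * s \<Longrightarrow>
      if opens_bin A (take (Suc i) X) then \<theta>A < X ! i else X ! i < \<theta>A"
    and Y_adaptive: "\<And>i. i < 20 * s \<Longrightarrow>
      if opens_bin A (X @ take (Suc i) Y) then \<theta>B < Y ! i else Y ! i < \<theta>B"
begin

abbreviation "bin i \<equiv> fst (online_packing A (X @ Y) i)"
abbreviation "IA \<equiv> {..<15 * s}"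
abbreviation "IB \<equiv> {15 * s..<35 * s}"
definition "LA = {i. 0 \<le> i \<and> i < 15 * s \<and> bin i \<notin> bin ` {..<i}}"
definition "LB = {i. 15 * s \<le> i \<and> i < 35 * s \<and> bin i \<notin> bin ` {..<i}}"
definition "DA = bin ` IA"
definition "DB = bin ` {..<35 * s} - bin ` IA"
definition "open_bins = {q \<in> DA \<union> DB. card {i \<in> {..<35 * s}. bin i = q} \<le> 5 \<and>
  card {i \<in> IB. bin i = q} \<le> 3}"

lemma finite_bins [simp]: "finite DA" "finite DB" "finite open_bins"
  by (simp_all add: DA_def DB_def open_bins_def)

lemma DA_DB: "DA \<inter> DB = {}" "DA \<union> DB = bin ` {..<35 * s}"
  by (auto simp: DA_def DB_def)

lemma L_subset: "LA \<subseteq> IA" "LB \<subseteq> IB" "finite LA" "finite LB"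
  by (auto simp: LA_def LB_def)

text \<open>Each bin opened during a group has one opener there. The form of \<open>LA\<close> is
  that of \<open>card_first_occurrences\<close> with \<open>m = 0\<close>.\<close>

lemma card_L: "card LA = card DA" "card LB = card DB"
  unfolding LA_def LB_def DA_def DB_def
  by (subst card_first_occurrences; simp)+

lemma square_instances: "square_instance X" "square_instance (X @ Y)"
  using X(2) Y(2) unfolding square_instance_def by force+

lemma A_size: "i \<in> IA \<Longrightarrow> 1/4 < (X @ Y) ! i \<and> (X @ Y) ! i < 5/18"
  using X subsetD[OF X(2) nth_mem[of i X]] by (auto simp: nth_append)

lemma B_size: "i \<in> IB \<Longrightarrow> 1/3 < (X @ Y) ! i \<and> (X @ Y) ! i < 13/36"
  using X(1) Y(1) subsetD[OF Y(2) nth_mem[of "i - 15 * s"]] by (auto simp: nth_append)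

lemma A_threshold: "i \<in> IA \<Longrightarrow> if i \<in> LA then \<theta>A < (X @ Y) ! i else (X @ Y) ! i < \<theta>A"
  using X_adaptive[of i] opens_bin_take_iff[of i "X @ Y" A] X(1)
  by (auto simp: LA_def nth_append)

lemma B_threshold:
  assumes "i \<in> IB"
  shows "if i \<in> LB then \<theta>B < (X @ Y) ! i else (X @ Y) ! i < \<theta>B"
proof -
  have "take (Suc i) (X @ Y) = X @ take (Suc (i - 15 * s)) Y"
    using assms X(1) by (simp add: Suc_diff_le)
  then have "opens_bin A (X @ take (Suc (i - 15 * s)) Y) \<longleftrightarrow> i \<in> LB"
    using opens_bin_take_iff[of i "X @ Y" A] assms X(1) Y(1) by (auto simp: LB_def)
  then show ?thesis
    using Y_adaptive[of "i - 15 * s"] assms X(1) by (auto simp: nth_append)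
qed

lemma valid: "valid_packing (X @ Y) (online_packing A (X @ Y))"
  using alg square_instances unfolding online_algorithm_def by blast

lemma A_bin_has_large:
  assumes "i \<in> IA"
  obtains j where "j \<in> LA" "bin j = bin i"
proof -
  have "bin i \<in> bin ` IA - bin ` {..<0}" using assms by auto
  then show thesis by (rule first_occurrence) (use that in \<open>auto simp: LA_def\<close>)
qed

text \<open>A bin outside \<open>DA\<close> holds no square of the first group, so its first square
  belongs to the second.\<close>

lemma B_bin_has_large:
  assumes "i < 35 * s" "bin i \<notin> DA"
  obtains j where "j \<in> LB" "bin j = bin i"
proof -
  have "bin i \<in> bin ` {..<35 * s} - bin ` IA" using assms by (auto simp: DA_def)
  then show thesis by (rule first_occurrence) (use that in \<open>auto simp: LB_def\<close>)
qed

text \<open>Each bin of \<open>DA\<close> holds at most 9 squares, an open one at most 5, hence 4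
  fewer. All of the first group lies in these bins.\<close>

lemma A_bins_capacity:
  "15 * s + (\<Sum>q\<in>DA. card {i \<in> IB. bin i = q}) + 4 * card (open_bins \<inter> DA) \<le> 9 * card DA"
proof -
  have "15 * s = (\<Sum>q\<in>DA. card {i \<in> IA. bin i = q})"
    using sum.image_gen[of IA "\<lambda>_. 1::nat" bin] by (simp add: DA_def)
  moreover have "4 * card (open_bins \<inter> DA) = (\<Sum>q\<in>DA. if q \<in> open_bins then 4 else 0)"
    by (simp add: sum.If_cases Int_commute)
  moreover have "(\<Sum>q\<in>DA. card {i \<in> IA. bin i = q} + card {i \<in> IB. bin i = q}
      + (if q \<in> open_bins then 4 else 0)) \<le> (\<Sum>q\<in>DA. 9)"
  proof (rule sum_mono)
    fix q
    let ?Q = "{i \<in> {..<35 * s}. bin i = q}"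
    have "card {i \<in> IA. bin i = q} + card {i \<in> IB. bin i = q}
        = card ({i \<in> IA. bin i = q} \<union> {i \<in> IB. bin i = q})"
      by (intro card_Un_disjoint[symmetric]) auto
    also have "{i \<in> IA. bin i = q} \<union> {i \<in> IB. bin i = q} = ?Q" by auto
    finally have eq: "card {i \<in> IA. bin i = q} + card {i \<in> IB. bin i = q} = card ?Q" .
    have "1/4 < (X @ Y) ! i" if "i < 35 * s" for i
      using A_size[of i] B_size[of i] that by fastforce
    then have "card ?Q + 3 * card {i \<in> ?Q. 1/2 < (X @ Y) ! i} \<le> 9"
      using X(1) Y(1) by (intro bin_capacity_quarter[OF valid, of _ q]) auto
    then show "card {i \<in> IA. bin i = q} + card {i \<in> IB. bin i = q}
        + (if q \<in> open_bins then 4 else 0) \<le> 9"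
      using eq by (auto simp: open_bins_def)
  qed
  ultimately show ?thesis by (simp add: sum.distrib)
qed

text \<open>Squares of the second group outside \<open>DA\<close> lie in bins of \<open>DB\<close>,
  at most 4 in each and at most 3 in an open one.\<close>

lemma B_bins_capacity:
  "20 * s + card (open_bins \<inter> DB) \<le> 4 * card DB + (\<Sum>q\<in>DA. card {i \<in> IB. bin i = q})"
proof -
  have "20 * s = (\<Sum>q\<in>bin ` IB. card {i \<in> IB. bin i = q})"
    using sum.image_gen[of IB "\<lambda>_. 1::nat" bin] by simp
  also have "\<dots> \<le> (\<Sum>q\<in>DA \<union> DB. card {i \<in> IB. bin i = q})"
    unfolding DA_DB(2) by (intro sum_mono2) auto
  also have "\<dots> = (\<Sum>q\<in>DA. card {i \<in> IB. bin i = q}) + (\<Sum>q\<in>DB. card {i \<in> IB. bin i = q})"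
    by (intro sum.union_disjoint) (auto simp: DA_DB)
  finally have "20 * s \<le> \<dots>" .
  moreover have "card (open_bins \<inter> DB) = (\<Sum>q\<in>DB. if q \<in> open_bins then 1 else 0)"
    by (simp add: sum.If_cases Int_commute)
  moreover have "(\<Sum>q\<in>DB. card {i \<in> IB. bin i = q} + (if q \<in> open_bins then 1 else 0))
      \<le> (\<Sum>q\<in>DB. 4)"
  proof (rule sum_mono)
    fix q
    have "card {i \<in> IB. bin i = q} \<le> 4"
      using X(1) Y(1) B_size by (intro bin_capacity_third[OF valid, of _ q]) auto
    then show "card {i \<in> IB. bin i = q} + (if q \<in> open_bins then 1 else 0) \<le> 4"
      by (auto simp: open_bins_def)
  qed
  ultimately show ?thesis by (simp add: sum.distrib)
qed

lemma packing_cost_prefixes: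
  "packing_cost X (online_packing A (X @ Z)) = card DA"
  "packing_cost (X @ Y) (online_packing A ((X @ Y) @ Z)) = card DA + card DB"
proof -
  have "fst (online_packing A (X @ Z) i) = bin i" if "i < 15 * s" for i
    using that X(1) by (simp add: online_packing_append)
  then have "(\<lambda>i. fst (online_packing A (X @ Z) i)) ` {..<15 * s} = bin ` {..<15 * s}"
    by (intro image_cong) auto
  then show "packing_cost X (online_packing A (X @ Z)) = card DA"
    by (simp add: packing_cost_def X(1) DA_def)
  have "fst (online_packing A ((X @ Y) @ Z) i) = bin i" if "i < 35 * s" for i
    using that X(1) Y(1) by (intro arg_cong[where f = fst] online_packing_append) simp
  then have "(\<lambda>i. fst (online_packing A ((X @ Y) @ Z) i)) ` {..<35 * s} = bin ` {..<35 * s}"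
    by (intro image_cong) auto
  then have "packing_cost (X @ Y) (online_packing A ((X @ Y) @ Z)) = card (DA \<union> DB)"
    unfolding DA_DB(2) by (simp add: packing_cost_def X(1) Y(1))
  then show "packing_cost (X @ Y) (online_packing A ((X @ Y) @ Z)) = card DA + card DB"
    using DA_DB(1) by (simp add: card_Un_disjoint)
qed

subsection \<open>Continuation with squares of side just below 3/4\<close>

text \<open>\<open>M\<close> is the number of small squares over 5, rounded up: each new square
  shares an optimal bin with five of them, and the large ones are packed nine to a bin. The
  algorithm needs a new bin for each new square.\<close>

lemma quarter_branch:
  defines "M \<equiv> (15 * s - card DA + 4) div 5"
  defines "I \<equiv> X @ replicate M (1 - \<theta>A)"
  shows "square_instance I" "\<forall>i<length I. 1/4 < I ! i" "15 * s \<le> length I"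
    and "card DA + M \<le> online_cost A I"
    and "OPT I \<le> M + (card DA + 8) div 9"
proof -
  let ?p = "online_packing A I" and ?C = "{15 * s..<15 * s + M}"
  have I_nth: "\<And>i. i \<in> IA \<Longrightarrow> I ! i = (X @ Y) ! i" "\<And>i. i \<in> ?C \<Longrightarrow> I ! i = 1 - \<theta>A"
    by (auto simp: I_def nth_append X(1))
  have len: "length I = 15 * s + M" by (simp add: I_def X(1))
  show inst: "square_instance I"
    using X(2) \<theta>A unfolding square_instance_def I_def by force
  have "1/4 < I ! i" if "i < length I" for i
    using that len \<theta>A I_nth(1)[of i] I_nth(2)[of i] A_size[of i] by (cases "i < 15 * s") auto
  then show "\<forall>i<length I. 1/4 < I ! i" by blast
  show "15 * s \<le> length I" by (simp add: len)
  have valid_I: "valid_packing I ?p"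
    using alg inst unfolding online_algorithm_def by blast
  have bin_I: "fst (?p i) = bin i" if "i \<in> IA" for i
    using that X(1) by (simp add: I_def online_packing_append)
  have "packing_cost X ?p + M \<le> packing_cost I ?p + card ({} :: nat set)"
    unfolding I_def
  proof (rule packing_cost_append_replicate)
    fix i m assume im: "i < length X" "length X \<le> m" "m < length X + M"
      "fst (online_packing A (X @ replicate M (1 - \<theta>A)) i)
       = fst (online_packing A (X @ replicate M (1 - \<theta>A)) m)"
    \<comment> \<open>The square \<open>i\<close> itself may be small; the one that opened its bin
      is above \<open>\<theta>A\<close> and leaves no room for side
      \<open>1 - \<theta>A\<close>.\<close>
    obtain j where j: "j \<in> LA" "bin j = bin i"
      using A_bin_has_large[of i] im X(1) by auto
    have jA: "j \<in> IA" using j(1) L_subset by auto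
    have "I ! j + I ! m \<le> 1"
    proof (rule sides_in_same_bin[OF valid_I])
      show "fst (?p j) = fst (?p m)"
        using im j bin_I[of i] bin_I[OF jA] X(1) unfolding I_def by simp
    qed (use im jA X(1) len I_nth A_size[of j] \<theta>A in auto)
    moreover have "\<theta>A < I ! j" using A_threshold[OF jA] j I_nth(1)[OF jA] by simp
    moreover have "I ! m = 1 - \<theta>A" using im X(1) by (intro I_nth) simp
    ultimately show "fst (online_packing A (X @ replicate M (1 - \<theta>A)) i) \<in> {}" by simp
  qed (use valid_I \<theta>A in \<open>auto simp: I_def\<close>)
  then show "card DA + M \<le> online_cost A I"
    using packing_cost_prefixes(1) by (simp add: online_cost_def I_def)
  \<comment> \<open>The five cells lie along the upper and right edges, around a square of side
    \<open>1 - \<theta>A\<close>.\<close>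
  have small: "packs I ((IA - LA) \<union> {} \<union> ?C) M"
  proof (rule packs_grid[where u = \<theta>A and R = "{}" and T = "{(0, 2), (2, 0), (2, 2), (1, 2), (2, 1)}"])
    have "card (IA - LA) = 15 * s - card DA"
      using L_subset card_L by (simp add: card_Diff_subset)
    also have "\<dots> \<le> M * 5" unfolding M_def by linarith
    finally show "card (IA - LA) + card ({} :: nat set)
        \<le> M * card {(0, 2), (2, 0), (2, 2), (1, 2), (2, 1) :: nat \<times> nat}"
      by simp
    show "0 < I ! i \<and> I ! i \<le> \<theta>A \<and> I ! i \<le> 1 - 2 * \<theta>A" if "i \<in> IA - LA" for i
      using that A_threshold[of i] I_nth(1)[of i] A_size[of i] \<theta>A by auto
    show "0 < I ! i \<and> I ! i \<le> 1 - \<theta>A" if "i \<in> ?C" for i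
      using I_nth(2)[OF that] \<theta>A by auto
  qed (use \<theta>A in auto)
  have large: "packs I (LA \<union> {} \<union> {}) ((card DA + 8) div 9)"
  proof (rule packs_grid[where u = "1/3" and R = "{}" and T = "{..2} \<times> {..2}"])
    show "card LA + card ({} :: nat set) \<le> (card DA + 8) div 9 * card ({..2} \<times> {..2} :: (nat \<times> nat) set)"
      by (simp add: card_cartesian_product card_L)
    show "0 < I ! i \<and> I ! i \<le> 1/3 \<and> I ! i \<le> 1 - 2 * (1/3)" if "i \<in> LA" for i
      using that L_subset I_nth(1)[of i] A_size[of i] by force
  qed (use L_subset in auto)
  have "(IA - LA \<union> {} \<union> ?C) \<union> (LA \<union> {} \<union> {}) = {..<length I}"
    using L_subset len by auto
  then show "OPT I \<le> M + (card DA + 8) div 9"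
    using packs_union[OF small large] OPT_le_if_packs by metis
qed

subsection \<open>Continuation with squares of side just below 2/3\<close>

text \<open>Serves both continuations after the second group. \<open>D\<close> collects the bins of
  \<open>DB\<close> that may be reused: all of them in \<open>half_branch\<close>, none in
  \<open>third_branch\<close>.\<close>

lemma third_branch_cost:
  fixes \<theta> :: real and M :: nat and D :: "nat set"
  assumes \<theta>: "\<theta> \<in> \<rat>" "1/4 < \<theta>" "\<theta> < 1/2"
    and blocked: "\<forall>q\<in>DB - D. \<exists>j\<in>IB. bin j = q \<and> \<theta> < (X @ Y) ! j"
  defines "I \<equiv> (X @ Y) @ replicate M (1 - \<theta>)"
  shows "square_instance I" "\<forall>i<length I. 1/4 < I ! i" "15 * s \<le> length I"
    and "card DA + card DB + M \<le> online_cost A I + card (open_bins \<inter> (DA \<union> D))"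
proof -
  let ?p = "online_packing A I" and ?C = "{35 * s..<35 * s + M}"
  have len_XY: "length (X @ Y) = 35 * s" using X(1) Y(1) by simp
  have len: "length I = 35 * s + M" by (simp add: I_def X(1) Y(1))
  have I_nth: "\<And>i. i < 35 * s \<Longrightarrow> I ! i = (X @ Y) ! i" "\<And>i. i \<in> ?C \<Longrightarrow> I ! i = 1 - \<theta>"
    unfolding I_def using len_XY by (auto simp: nth_append[of "X @ Y"] simp del: length_append append_assoc)
  show inst: "square_instance I"
    using square_instances(2) \<theta> unfolding square_instance_def I_def by auto
  have size: "1/4 < I ! i" if "i < length I" for i
    using that len \<theta> I_nth(1)[of i] I_nth(2)[of i] A_size[of i] B_size[of i]
    by (cases "i < 15 * s"; cases "i < 35 * s") auto
  then show "\<forall>i<length I. 1/4 < I ! i" by blast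
  show "15 * s \<le> length I" by (simp add: len)
  have valid_I: "valid_packing I ?p"
    using alg inst unfolding online_algorithm_def by blast
  have bin_I: "fst (?p i) = bin i" if "i < 35 * s" for i
    unfolding I_def using that len_XY by (intro arg_cong[where f = fst] online_packing_append) simp
  have "packing_cost (X @ Y) ?p + M \<le> packing_cost I ?p + card (open_bins \<inter> (DA \<union> D))"
    unfolding I_def
  proof (rule packing_cost_append_replicate, fold I_def)
    fix i m assume im: "i < length (X @ Y)" "length (X @ Y) \<le> m" "m < length (X @ Y) + M"
      "fst (?p i) = fst (?p m)"
    have i: "i < 35 * s" and m: "m \<in> ?C" using im len_XY by auto
    define q where "q = bin i"
    have pm: "fst (?p m) = q" using im(4) bin_I[OF i] by (simp add: q_def)
    have half: "m < length I" "1/2 < I ! m" using m len \<theta> I_nth(2)[OF m] by auto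
    \<comment> \<open>A bin that receives a square of side above 1/2 satisfies both bounds of
      \<open>open_bins\<close>.\<close>
    have "card {i \<in> {..<35 * s}. bin i = q} \<le> 5"
      using m len size bin_I pm by (intro bin_capacity_beside_half(1)[OF valid_I half]) auto
    moreover have "card {i \<in> IB. bin i = q} \<le> 3"
      using m len B_size I_nth(1) bin_I pm
      by (intro bin_capacity_beside_half(2)[OF valid_I half]) auto
    moreover have "q \<in> DA \<union> DB" unfolding DA_DB(2) q_def using i by auto
    ultimately have "q \<in> open_bins" by (simp add: open_bins_def)
    moreover have False if q: "q \<in> DB - D"
    proof -
      obtain j where j: "j \<in> IB" "bin j = q" "\<theta> < (X @ Y) ! j" using blocked q by blast
      have "I ! j + I ! m \<le> 1"
      proof (rule sides_in_same_bin[OF valid_I])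
        show "fst (?p j) = fst (?p m)" using j bin_I[of j] pm by simp
        show "0 < I ! j" using size[of j] j len by simp
      qed (use m j len half in auto)
      then show False using j I_nth(1)[of j] I_nth(2)[OF m] by simp
    qed
    ultimately show "fst (?p i) \<in> open_bins \<inter> (DA \<union> D)"
      using \<open>q \<in> DA \<union> DB\<close> bin_I[OF i] q_def by auto
  qed (use valid_I \<theta> in auto)
  moreover have "packing_cost (X @ Y) ?p = card DA + card DB"
    unfolding I_def by (rule packing_cost_prefixes)
  ultimately show "card DA + card DB + M \<le> online_cost A I + card (open_bins \<inter> (DA \<union> D))"
    by (simp add: online_cost_def)
qed

text \<open>With \<open>u = 13/36\<close> the middle width is 5/18, so the grid suits both groups.
  The 35 \<open>s\<close> squares fill the five free cells of 7 \<open>s\<close> bins exactly, and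
  the 20 \<open>s\<close> of the second group fit into the 21 \<open>s\<close> corners.\<close>

lemma half_branch:
  defines "I \<equiv> (X @ Y) @ replicate (7 * s) (1 - 13/36)"
  shows "square_instance I" "\<forall>i<length I. 1/4 < I ! i" "15 * s \<le> length I"
    and "card DA + card DB + 7 * s \<le> online_cost A I + card (open_bins \<inter> DA) + card (open_bins \<inter> DB)"
    and "OPT I \<le> 7 * s"
proof -
  have \<theta>: "13/36 \<in> \<rat>" "1/4 < (13/36 :: real)" "13/36 < (1/2 :: real)" by simp_all
  have "open_bins \<inter> (DA \<union> DB) = open_bins \<inter> DA \<union> open_bins \<inter> DB" by auto
  then have "card (open_bins \<inter> (DA \<union> DB)) = card (open_bins \<inter> DA) + card (open_bins \<inter> DB)"
    using DA_DB(1) by (simp add: card_Un_disjoint disjoint_iff)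
  moreover have "\<forall>q\<in>DB - DB. \<exists>j\<in>IB. bin j = q \<and> 13/36 < (X @ Y) ! j" by simp
  note cost = third_branch_cost[OF \<theta> this, of "7 * s", folded I_def]
  ultimately show "square_instance I" "\<forall>i<length I. 1/4 < I ! i" "15 * s \<le> length I"
    "card DA + card DB + 7 * s \<le> online_cost A I + card (open_bins \<inter> DA) + card (open_bins \<inter> DB)"
    using cost by (simp_all only: add.assoc)
  let ?C = "{35 * s..<42 * s}"
  have len_XY: "length (X @ Y) = 35 * s" using X(1) Y(1) by simp
  have I_nth: "\<And>i. i < 35 * s \<Longrightarrow> I ! i = (X @ Y) ! i" "\<And>i. i \<in> ?C \<Longrightarrow> I ! i = 1 - 13/36"
    unfolding I_def using len_XY by (auto simp: nth_append[of "X @ Y"] simp del: length_append append_assoc)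
  have "packs I (IA \<union> IB \<union> ?C) (7 * s)"
  proof (rule packs_grid[where u = "13/36" and R = "{(0, 2), (2, 0), (2, 2)}"
        and T = "{(0, 2), (2, 0), (2, 2), (1, 2), (2, 1)}"])
    show "0 < I ! i \<and> I ! i \<le> 13/36 \<and> I ! i \<le> 1 - 2 * (13/36)" if "i \<in> IA" for i
      using that I_nth(1)[of i] A_size[of i] by auto
    show "0 < I ! i \<and> I ! i \<le> 13/36" if "i \<in> IB" for i
      using that I_nth(1)[of i] B_size[of i] by auto
    show "0 < I ! i \<and> I ! i \<le> 1 - 13/36" if "i \<in> ?C" for i
      using I_nth(2)[OF that] by auto
  qed auto
  moreover have "IA \<union> IB \<union> ?C = {..<length I}"
    by (auto simp: I_def X(1) Y(1))
  ultimately show "OPT I \<le> 7 * s" using OPT_le_if_packs by metis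
qed

text \<open>Each of \<open>M\<close> bins takes a new square, three small squares of the second
  group in corners and two of the first between them. The large ones go four to a bin, leaving five
  cells for the rest of the first group.\<close>

lemma third_branch:
  assumes DB: "20 * s \<le> 7 * card DB"
  defines "M \<equiv> (20 * s - card DB + 2) div 3"
  defines "I \<equiv> (X @ Y) @ replicate M (1 - \<theta>B)"
  shows "square_instance I" "\<forall>i<length I. 1/4 < I ! i" "15 * s \<le> length I"
    and "card DA + card DB + M \<le> online_cost A I + card (open_bins \<inter> DA)"
    and "OPT I \<le> M + (card DB + 3) div 4"
proof -
  have \<theta>: "\<theta>B \<in> \<rat>" "1/4 < \<theta>B" "\<theta>B < 1/2" using \<theta>B by auto
  have "\<forall>q\<in>DB - {}. \<exists>j\<in>IB. bin j = q \<and> \<theta>B < (X @ Y) ! j"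
  proof
    fix q assume "q \<in> DB - {}"
    then obtain i where i: "i < 35 * s" "bin i = q" "bin i \<notin> DA" by (auto simp: DB_def DA_def)
    obtain j where "j \<in> LB" "bin j = q" using B_bin_has_large[OF i(1,3)] i(2) by metis
    then show "\<exists>j\<in>IB. bin j = q \<and> \<theta>B < (X @ Y) ! j"
      using B_threshold[of j] L_subset(2) by (metis subsetD)
  qed
  from third_branch_cost[OF \<theta> this, of M, folded I_def]
  show "square_instance I" "\<forall>i<length I. 1/4 < I ! i" "15 * s \<le> length I"
    "card DA + card DB + M \<le> online_cost A I + card (open_bins \<inter> DA)"
    by simp_all
  let ?C = "{35 * s..<35 * s + M}"
  have len_XY: "length (X @ Y) = 35 * s" using X(1) Y(1) by simp
  have I_nth: "\<And>i. i < 35 * s \<Longrightarrow> I ! i = (X @ Y) ! i" "\<And>i. i \<in> ?C \<Longrightarrow> I ! i = 1 - \<theta>B"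
    unfolding I_def using len_XY by (auto simp: nth_append[of "X @ Y"] simp del: length_append append_assoc)
  \<comment> \<open>As many squares of the first group as the two middle cells of \<open>M\<close>
    bins can take.\<close>
  obtain S where S: "S \<subseteq> IA" "card S = min (2 * M) (15 * s)"
    using obtain_subset_with_card_n[of "min (2 * M) (15 * s)" IA] by auto
  have finS: "finite S" using S(1) finite_subset by blast
  have card_small: "card (IB - LB) = 20 * s - card DB"
    using L_subset card_L by (simp add: card_Diff_subset)
  have M3: "20 * s - card DB \<le> M * 3" unfolding M_def by linarith
  have small: "packs I (S \<union> (IB - LB) \<union> ?C) M"
  proof (rule packs_grid[where u = \<theta>B and R = "{(0, 2), (2, 0), (2, 2)}"
        and T = "{(0, 2), (2, 0), (2, 2), (1, 2), (2, 1)}"])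
    show "card (IB - LB) \<le> M * card {(0, 2), (2, 0), (2, 2) :: nat \<times> nat}"
      using M3 card_small by simp
    show "card S + card (IB - LB) \<le> M * card {(0, 2), (2, 0), (2, 2), (1, 2), (2, 1) :: nat \<times> nat}"
      using M3 S(2) card_small by simp
    show "0 < I ! i \<and> I ! i \<le> \<theta>B \<and> I ! i \<le> 1 - 2 * \<theta>B" if "i \<in> S" for i
      using that S(1) I_nth(1)[of i] A_size[of i] \<theta>B by auto
    show "0 < I ! i \<and> I ! i \<le> \<theta>B" if "i \<in> IB - LB" for i
      using that I_nth(1)[of i] B_threshold[of i] B_size[of i] by auto
    show "0 < I ! i \<and> I ! i \<le> 1 - \<theta>B" if "i \<in> ?C" for i
      using I_nth(2)[OF that] \<theta> by auto
  qed (use \<theta> S(1) finS in auto)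
  have "card (IA - S) = 15 * s - min (2 * M) (15 * s)"
    using S finS by (simp add: card_Diff_subset)
  \<comment> \<open>Up to rounding, 15 \<open>s\<close> - 2 (20 \<open>s\<close> -
    \<open>b\<close>)/3 is at most 5 \<open>b\<close>/4 for \<open>b = card DB\<close>, which
    amounts to the assumption \<open>DB\<close>.\<close>
  then have card_rest: "card (IA - S) + card DB \<le> (card DB + 3) div 4 * 9"
    using M3 DB by linarith
  have large: "packs I ((IA - S) \<union> LB \<union> {}) ((card DB + 3) div 4)"
  proof (rule packs_grid[where u = "13/36" and R = "{0, 2} \<times> {0, 2}" and T = "{..2} \<times> {..2}"])
    show "card LB \<le> (card DB + 3) div 4 * card ({0, 2} \<times> {0, 2} :: (nat \<times> nat) set)"
      unfolding card_L card_cartesian_product by simp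
    show "card (IA - S) + card LB \<le> (card DB + 3) div 4 * card ({..2} \<times> {..2} :: (nat \<times> nat) set)"
      using card_rest by (simp add: card_cartesian_product card_L)
    show "0 < I ! i \<and> I ! i \<le> 13/36 \<and> I ! i \<le> 1 - 2 * (13/36)" if "i \<in> IA - S" for i
      using that I_nth(1)[of i] A_size[of i] by auto
    show "0 < I ! i \<and> I ! i \<le> 13/36" if "i \<in> LB" for i
      using that L_subset I_nth(1)[of i] B_size[of i] by force
  qed (use L_subset in auto)
  have "(S \<union> (IB - LB) \<union> ?C) \<union> ((IA - S) \<union> LB \<union> {}) = {..<length I}"
    using L_subset S(1) by (auto simp: I_def X(1) Y(1))
  then show "OPT I \<le> M + (card DB + 3) div 4"
    using packs_union[OF small large] OPT_le_if_packs by metis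
qed

subsection \<open>Combining the three continuations\<close>

text \<open>The continuations and capacities yield incompatible linear inequalities. Their slack is
  proportional to \<open>s\<close>, and from 1000000 on it absorbs the constants due to
  rounding.\<close>

lemma bad_instance:
  assumes s: "1000000 \<le> s"
  shows "\<exists>I. square_instance I \<and> (\<forall>i<length I. 1/4 < I ! i) \<and> 15 * s \<le> length I \<and>
    1.7515445 * real (OPT I) \<le> real (online_cost A I)"
proof (rule ccontr)
  assume contra: "\<not> ?thesis"
  define a b pA pB jA where "a = real (card DA)" and "b = real (card DB)"
    and "pA = real (card (open_bins \<inter> DA))" and "pB = real (card (open_bins \<inter> DB))"
    and "jA = real (\<Sum>q\<in>DA. card {i \<in> IB. bin i = q})"
  define t where "t = real s"
  have t: "1000000 \<le> t" using s by (simp add: t_def)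
  have nonneg: "0 \<le> a" "0 \<le> b" "0 \<le> pA" "0 \<le> pB" "0 \<le> jA"
    unfolding a_def b_def pA_def pB_def jA_def by (rule of_nat_0_le_iff)+
  have A_cap: "15 * t + jA + 4 * pA \<le> 9 * a"
    using A_bins_capacity unfolding t_def jA_def pA_def a_def by linarith
  have B_cap: "20 * t + pB \<le> 4 * b + jA"
    using B_bins_capacity unfolding t_def jA_def pB_def b_def by linarith
  have a_le: "a \<le> 15 * t"
    using card_mono[OF _ L_subset(1)] card_L(1) by (simp add: a_def t_def)
  have b_le: "b \<le> 20 * t"
    using card_mono[OF _ L_subset(2)] card_L(2) by (simp add: b_def t_def)
  have lt: "real c < 1.7515445 * real k"
    if "square_instance I" "\<forall>i<length I. 1/4 < I ! i" "15 * s \<le> length I"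
      "OPT I \<le> k" "c \<le> online_cost A I" for I c k
  proof -
    have "real (online_cost A I) < 1.7515445 * real (OPT I)" using contra that(1-3) by force
    moreover have "1.7515445 * real (OPT I) \<le> 1.7515445 * real k" using that(4) by simp
    ultimately show ?thesis using that(5) by linarith
  qed
  have quarter: "a + (15 * t - a) / 5 < 1.7515445 * ((15 * t - a + 4) / 5 + (a + 8) / 9)"
  proof -
    let ?M = "(15 * s - card DA + 4) div 5" and ?K = "(card DA + 8) div 9"
    have M: "(15 * t - a) / 5 \<le> real ?M" "real ?M \<le> (15 * t - a + 4) / 5" "real ?K \<le> (a + 8) / 9"
      using a_le unfolding t_def a_def by (simp; linarith)+
    have "real (card DA + ?M) < 1.7515445 * real (?M + ?K)"
      by (rule lt[OF quarter_branch(1-3,5,4)])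
    then have "a + real ?M < 1.7515445 * (real ?M + real ?K)" by (simp add: a_def)
    \<comment> \<open>Reals \<open>m\<close> and \<open>k\<close> replace the rounded quotients, so
      that the arithmetic sees only their bounds.\<close>
    moreover have "?thesis" if "a + m < 1.7515445 * (m + k)" "(15 * t - a) / 5 \<le> m"
        "m \<le> (15 * t - a + 4) / 5" "k \<le> (a + 8) / 9" for m k :: real
      using that by (simp add: field_simps)
    ultimately show ?thesis using M by blast
  qed
  have half: "a + b + 7 * t - pA - pB < 1.7515445 * (7 * t)"
  proof -
    let ?c = "card DA + card DB + 7 * s - card (open_bins \<inter> DA) - card (open_bins \<inter> DB)"
    have "real ?c < 1.7515445 * real (7 * s)"
      by (rule lt[OF half_branch(1-3,5)]) (use half_branch(4) in linarith)
    then show ?thesis unfolding a_def b_def pA_def pB_def t_def by linarith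
  qed
  have r: "1.7515445 = (3503089 / 2000000 :: real)" by simp
  \<comment> \<open>If \<open>7 b \<ge> 20 s\<close>, the squares just above 1/4 fill the gaps in the packing of
    \<open>third_branch\<close>. Otherwise so many bins were opened for them that \<open>quarter_branch\<close> suffices.\<close>
  show False
  proof (cases "20 * s \<le> 7 * card DB")
    case True
    let ?M = "(20 * s - card DB + 2) div 3" and ?K = "(card DB + 3) div 4"
    let ?c = "card DA + card DB + ?M - card (open_bins \<inter> DA)"
    have M: "(20 * t - b) / 3 \<le> real ?M" "real ?M \<le> (20 * t - b + 2) / 3" "real ?K \<le> (b + 3) / 4"
      using b_le unfolding t_def b_def by (simp; linarith)+
    have "real ?c < 1.7515445 * real (?M + ?K)"
      by (rule lt[OF third_branch(1-3,5)[OF True]]) (use third_branch(4)[OF True] in linarith)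
    moreover have "a + b + real ?M - pA \<le> real ?c"
      unfolding a_def b_def pA_def by linarith
    ultimately have "a + b + real ?M - pA < 1.7515445 * (real ?M + real ?K)" by simp
    moreover have "a + b + (20 * t - b) / 3 - pA < 1.7515445 * ((20 * t - b + 2) / 3 + (b + 3) / 4)"
      if "a + b + m - pA < 1.7515445 * (m + k)" "(20 * t - b) / 3 \<le> m"
        "m \<le> (20 * t - b + 2) / 3" "k \<le> (b + 3) / 4" for m k :: real
      using that by (simp add: field_simps)
    ultimately have "a + b + (20 * t - b) / 3 - pA < 1.7515445 * ((20 * t - b + 2) / 3 + (b + 3) / 4)"
      using M by blast
    \<comment> \<open>Adding the two capacity bounds cancels \<open>jA\<close> and bounds
      \<open>pB\<close>, which is then eliminated from \<open>half\<close>.\<close>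
    moreover have "35 * t + 3 * pA - 8 * a - 3 * b < (1.7515445 - 1) * (7 * t)"
      using half A_cap B_cap by (simp add: field_simps)
    \<comment> \<open>Eliminating \<open>b\<close> leaves \<open>pA\<close> with a negative
      coefficient, so an upper bound on it is needed. The result is \<open>a\<close> above about
      2.3593 \<open>t\<close>, whereas \<open>quarter\<close> keeps it below about 2.3592
      \<open>t\<close>.\<close>
    moreover have "4 * pA \<le> 9 * a - 15 * t" using A_cap nonneg by linarith
    ultimately show False using quarter t unfolding r by (simp add: field_simps)
  next
    case False
    then have "7 * b < 20 * t" unfolding b_def t_def by linarith
    moreover have "35 * t \<le> 9 * a + 4 * b" using A_cap B_cap nonneg by linarith
    ultimately show False using quarter t unfolding r by (simp add: field_simps)
  qed
qed

end

theorem theorem3: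
  fixes A :: "real list \<Rightarrow> placement"
  assumes "online_algorithm A"
  shows "asymptotic_competitive_ratio A \<ge> ereal 1.7515445"
proof (rule ratio_geI)
  fix K :: nat
  \<comment> \<open>The input has at least 15 \<open>s\<close> squares, at most nine fit into a bin,
    so the optimum is at least \<open>s\<close> and hence \<open>K\<close>.\<close>
  define s where "s = max 1000000 K"
  obtain X \<theta>A where X: "length X = 15 * s" "set X \<subseteq> \<rat> \<inter> {1/4<..<5/18}" "\<theta>A \<in> \<rat> \<inter> {1/4<..<5/18}"
      "\<forall>i<15 * s. if opens_bin A ([] @ take (Suc i) X) then \<theta>A < X ! i else X ! i < \<theta>A"
    using adaptive_items[of "1/4" "5/18" "15 * s" "opens_bin A" "[]"] by auto
  obtain Y \<theta>B where Y: "length Y = 20 * s" "set Y \<subseteq> \<rat> \<inter> {1/3<..<13/36}" "\<theta>B \<in> \<rat> \<inter> {1/3<..<13/36}"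
      "\<forall>i<20 * s. if opens_bin A (X @ take (Suc i) Y) then \<theta>B < Y ! i else Y ! i < \<theta>B"
    using adaptive_items[of "1/3" "13/36" "20 * s" "opens_bin A" X] by auto
  interpret adversary A X Y \<theta>A \<theta>B s
    using assms X Y by unfold_locales simp_all
  obtain I where I: "square_instance I" "\<forall>i<length I. 1/4 < I ! i" "15 * s \<le> length I"
      "1.7515445 * real (OPT I) \<le> real (online_cost A I)"
    using bad_instance by (auto simp: s_def)
  have "length I \<le> 9 * OPT I" using I by (intro length_le_OPT) auto
  then have "K \<le> OPT I" using I(3) by (simp add: s_def)
  then show "\<exists>I. square_instance I \<and> K \<le> OPT I \<and> 1.7515445 * real (OPT I) \<le> real (online_cost A I)"
    using I by blast
qed

end
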